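(* Let $f(x)\in\mathbb{Q}[x]$ be an irreducible polynomial. Then the following two conditions are equivalent: (1) all roots of $f(x)$ (in $\mathbb{C}$) are real; (2) there exists a polynomial $F(x)\in\mathbb{Q}[x]$ such that all roots of $F(x)$ are rational and $f(x)$ divides the derivative $F'(x)$.
   Formalization: In condition (2) the polynomial F is required to be non-constant; with F = 1 condition (2) would hold for every f, and the equivalence would fail for f = x^2 + 1. *)

theory Defs
  imports Complex_Main "HOL-Computational_Algebra.Polynomial"
begin

end

(* If f has degree d with simple real roots x_0 < ... < x_{d-1}, choose rationals
   a_0 < x_0 < a_1 < ... < x_{d-1} < a_d and put g = (X - a_0) ... (X - a_d). By Lagrange
   interpolation f / g is the sum of the f(a_i) / g'(a_i) / (X - a_i), and by the interlacing all
   these residues have the sign of the leading coefficient of f. Multiplied by a common denominator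
   they become positive integers n_i, and F = prod (X - a_i)^(n_i) has logarithmic derivative
   proportional to f / g. Irreducibility only enters through the simplicity of the roots.
   The converse is the Gauss-Lucas argument: off the real line the imaginary part of F'/F
   does not vanish. *)
theory Submission
  imports Defs
    "HOL-Computational_Algebra.Computational_Algebra"
    "HOL-Computational_Algebra.Field_as_Ring"
begin

subsection \<open>Rational polynomials over larger fields\<close>

lemma coeff_map_poly_of_rat [simp]:
  "coeff (map_poly (of_rat :: rat \<Rightarrow> 'a::field_char_0) p) n = of_rat (coeff p n)"
  by (simp add: coeff_map_poly)

lemma map_poly_of_rat_add:
  "map_poly (of_rat :: rat \<Rightarrow> 'a::field_char_0) (p + q) = map_poly of_rat p + map_poly of_rat q"
  by (rule poly_eqI) (simp add: of_rat_add)

lemma map_poly_of_rat_mult: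
  "map_poly (of_rat :: rat \<Rightarrow> 'a::field_char_0) (p * q) = map_poly of_rat p * map_poly of_rat q"
  by (rule poly_eqI) (simp add: coeff_mult of_rat_sum of_rat_mult)

lemma map_poly_of_rat_pderiv:
  "map_poly (of_rat :: rat \<Rightarrow> 'a::field_char_0) (pderiv p) = pderiv (map_poly of_rat p)"
  by (rule poly_eqI) (simp add: coeff_pderiv of_rat_mult of_rat_add)

lemma of_real_of_rat [simp]: "of_real (of_rat q) = (of_rat q :: 'a::{real_div_algebra,field_char_0})"
proof (cases q rule: Rat_cases)
  case (Fract a b)
  then show ?thesis
    by (simp add: of_rat_rat)
qed

lemma poly_map_poly_of_rat:
  "poly (map_poly (of_rat :: rat \<Rightarrow> 'a::field_char_0) p) (of_rat a) = of_rat (poly p a)"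
  by (induction p) (simp_all add: map_poly_pCons of_rat_add of_rat_mult)

lemma degree_map_poly_of_rat [simp]:
  "degree (map_poly (of_rat :: rat \<Rightarrow> 'a::field_char_0) p) = degree p"
  by (rule degree_map_poly) simp

lemma poly_map_poly_of_rat_prod_linear:
  fixes z :: "'a::field_char_0"
  shows "poly (map_poly of_rat (\<Prod>a\<in>A. [:- a, 1:] ^ k a)) z = (\<Prod>a\<in>A. (z - of_rat a) ^ k a)"
proof -
  have lin: "poly (map_poly of_rat ([:- a, 1:] ^ n)) z = (z - of_rat a) ^ n" for a n
    by (induction n)
      (simp_all add: map_poly_of_rat_mult map_poly_pCons of_rat_minus del: mult_pCons_left)
  show ?thesis
    by (induction A rule: infinite_finite_induct) (simp_all add: map_poly_of_rat_mult lin)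
qed

text \<open>In characteristic 0 the derivative of \<open>f\<close> is nonzero and of smaller degree,
  so it is coprime to \<open>f\<close>. The Bezout identity over the rationals survives the
  embedding into any larger field and rules out a common root there.\<close>

lemma irreducible_imp_rsquarefree_map_poly_of_rat:
  fixes f :: "rat poly"
  assumes "irreducible f"
  shows "rsquarefree (map_poly (of_rat :: rat \<Rightarrow> 'a::field_char_0) f)"
  unfolding rsquarefree_roots
proof (intro allI notI)
  fix z :: 'a
  assume z: "poly (map_poly of_rat f) z = 0 \<and> poly (pderiv (map_poly of_rat f)) z = 0"
  have "f \<noteq> 0" "\<not> is_unit f"
    using assms by (auto simp: irreducible_def)
  then have "degree f \<noteq> 0"
    by (metis is_unit_iff_degree)
  then have "pderiv f \<noteq> 0"
    by (simp add: pderiv_eq_0_iff)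
  have "\<not> f dvd pderiv f"
  proof
    assume "f dvd pderiv f"
    then have "degree f \<le> degree (pderiv f)"
      using \<open>pderiv f \<noteq> 0\<close> by (rule dvd_imp_degree_le)
    then show False
      using \<open>degree f \<noteq> 0\<close> by (simp add: degree_pderiv)
  qed
  then have "coprime f (pderiv f)"
    using field_poly_irreducible_imp_prime[OF assms] by (simp add: prime_elem_imp_coprime)
  then obtain u v where "u * f + v * pderiv f = 1"
    by (metis bezout_coefficients_fst_snd coprime_imp_gcd_eq_1)
  then have "poly (map_poly of_rat (u * f + v * pderiv f)) z = (1 :: 'a)"
    by simp
  then show False
    using z by (simp add: map_poly_of_rat_add map_poly_of_rat_mult map_poly_of_rat_pderiv)
qed

subsection \<open>Critical points of real-rooted polynomials\<close>

text \<open>The logarithmic derivative is the sum of the \<open>1 / (z - r)\<close>, and for real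
  \<open>r\<close> the imaginary part of each term has the sign opposite to \<open>Im z\<close>. The
  factor \<open>Im z\<close> treats both half planes at once.\<close>

lemma Im_logarithmic_derivative_neg:
  assumes "\<And>r. r \<in># A \<Longrightarrow> r \<in> \<real>" "Im z \<noteq> 0" "A \<noteq> {#}"
  shows "Im z * Im (poly (pderiv (\<Prod>r\<in>#A. [:- r, 1:])) z / poly (\<Prod>r\<in>#A. [:- r, 1:]) z) < 0"
  using assms
proof (induction A)
  case (add r A)
  define P where "P = (\<Prod>r\<in>#A. [:- r, 1:])"
  have "poly P z \<noteq> 0"
    using add.prems by (auto simp: P_def poly_prod_mset prod_mset_zero_iff complex_is_Real_iff)
  moreover have "z - r \<noteq> 0"
    using add.prems by (auto simp: complex_is_Real_iff)
  moreover have "poly (pderiv ([:- r, 1:] * P)) z = poly P z + (z - r) * poly (pderiv P) z"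
    by (simp only: pderiv_mult) (simp add: pderiv_pCons algebra_simps)
  moreover have "poly ([:- r, 1:] * P) z = (z - r) * poly P z"
    by (simp add: algebra_simps)
  ultimately have "poly (pderiv ([:- r, 1:] * P)) z / poly ([:- r, 1:] * P) z
      = 1 / (z - r) + poly (pderiv P) z / poly P z"
    by (simp add: add_divide_distrib)
  moreover have "Im z * Im (1 / (z - r)) < 0"
  proof -
    have "Im r = 0"
      using add.prems by (auto simp: complex_is_Real_iff)
    then have "Im z * Im (1 / (z - r)) = - ((Im z)\<^sup>2 / ((Re z - Re r)\<^sup>2 + (Im z)\<^sup>2))"
      by (simp add: Im_divide power2_eq_square)
    also have "\<dots> < 0"
      using \<open>Im z \<noteq> 0\<close> by (simp add: add_nonneg_pos)
    finally show ?thesis .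
  qed
  \<comment> \<open>Only the weak inequality is available: for empty \<open>A\<close> the quotient
    is 0. The new summand supplies strictness.\<close>
  moreover have "Im z * Im (poly (pderiv P) z / poly P z) \<le> 0"
  proof (cases "A = {#}")
    case True
    then show ?thesis
      by (simp add: P_def)
  next
    case False
    then show ?thesis
      using add unfolding P_def by (simp add: less_imp_le)
  qed
  ultimately show ?case
    by (simp add: P_def[symmetric] distrib_left del: mult_pCons_left)
qed simp

text \<open>At a nonreal critical point the logarithmic derivative would be 0, against its strict
  sign. Positive degree provides at least one root, hence a nonempty multiset of factors.\<close>

lemma real_roots_pderiv:
  fixes p :: "complex poly"
  assumes "degree p > 0" "\<And>w. poly p w = 0 \<Longrightarrow> w \<in> \<real>" "poly (pderiv p) z = 0"
  shows "z \<in> \<real>"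
proof (rule ccontr)
  assume "z \<notin> \<real>"
  then have "Im z \<noteq> 0"
    by (simp add: complex_is_Real_iff)
  have "p \<noteq> 0"
    using assms(1) by auto
  define q where "q = (\<Prod>r\<in>#proots p. [:- r, 1:])"
  have p: "p = smult (lead_coeff p) q"
    unfolding q_def by (rule complex_poly_decompose_multiset[symmetric])
  have "poly (smult (lead_coeff p) (pderiv q)) z = 0"
    using assms(3) p by (metis pderiv_smult)
  then have "poly (pderiv q) z = 0"
    using \<open>p \<noteq> 0\<close> by simp
  moreover have "proots p \<noteq> {#}"
    using assms(1) size_proots_complex[of p] by auto
  ultimately show False
    using Im_logarithmic_derivative_neg[of "proots p" z] \<open>Im z \<noteq> 0\<close> \<open>p \<noteq> 0\<close> assms(2)
    by (simp add: q_def)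
qed

subsection \<open>Interpolation at points interlacing the roots\<close>

text \<open>Both sides have degree below \<open>card A\<close> and agree at every point of
  \<open>A\<close>.\<close>

lemma lagrange_interpolation:
  fixes f :: "'a::field poly"
  assumes "finite A" "degree f < card A"
  shows "f = (\<Sum>a\<in>A. smult (poly f a / (\<Prod>b\<in>A - {a}. a - b)) (\<Prod>b\<in>A - {a}. [:- b, 1:]))"
    (is "f = sum ?t A")
proof (rule poly_eqI_degree[of A])
  fix x assume x: "x \<in> A"
  have "poly (?t a) x = (if a = x then poly f x else 0)" if "a \<in> A" for a
  proof (cases "a = x")
    case True
    then show ?thesis
      using assms(1) by (simp add: poly_prod)
  next
    case False
    then have "(\<Prod>b\<in>A - {a}. x - b) = 0"
      using x assms(1) by (intro prod_zero) auto
    then show ?thesis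
      using False by (simp add: poly_prod)
  qed
  then show "poly f x = poly (sum ?t A) x"
    using x assms(1) by (simp add: poly_sum)
next
  have "degree (?t a) \<le> card A - 1" if "a \<in> A" for a
  proof -
    have "degree (?t a) \<le> degree (\<Prod>b\<in>A - {a}. [:- b, 1:])"
      by (rule degree_smult_le)
    also have "\<dots> = card (A - {a})"
      by (subst degree_prod_sum_eq) auto
    finally show ?thesis
      using that assms(1) by simp
  qed
  \<comment> \<open>The truncated subtraction is harmless, since \<open>degree f < card A\<close>
    forces \<open>card A\<close> to be positive.\<close>
  then have "degree (sum ?t A) \<le> card A - 1"
    using assms(1) by (intro degree_sum_le) auto
  then show "degree (sum ?t A) < card A"
    using assms(2) by linarith
qed (use assms in auto)

text \<open>By the product rule every summand keeps the factor \<open>[:- a, 1:] ^ m a\<close> for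
  each \<open>a\<close>. Writing exponents as \<open>Suc (m a)\<close> makes them positive and
  avoids subtraction. The sum on the right has the shape of a Lagrange expansion, to be matched with
  \<open>f\<close>.\<close>

lemma pderiv_prod_linear_powers:
  fixes A :: "'a::idom set"
  assumes "finite A"
  shows "pderiv (\<Prod>a\<in>A. [:- a, 1:] ^ Suc (m a)) =
    (\<Prod>a\<in>A. [:- a, 1:] ^ m a) * (\<Sum>a\<in>A. smult (of_nat (Suc (m a))) (\<Prod>b\<in>A - {a}. [:- b, 1:]))"
proof -
  have "(\<Prod>b\<in>A - {a}. [:- b, 1:] ^ Suc (m b)) * pderiv ([:- a, 1:] ^ Suc (m a)) =
      (\<Prod>b\<in>A. [:- b, 1:] ^ m b) * smult (of_nat (Suc (m a))) (\<Prod>b\<in>A - {a}. [:- b, 1:])"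
    if "a \<in> A" for a
  proof -
    have "pderiv ([:- a, 1:] ^ Suc (m a)) = smult (of_nat (Suc (m a))) ([:- a, 1:] ^ m a)"
      by (simp only: pderiv_power_Suc) (simp add: pderiv_pCons)
    moreover have "(\<Prod>b\<in>A - {a}. [:- b, 1:] ^ Suc (m b)) =
        (\<Prod>b\<in>A - {a}. [:- b, 1:]) * (\<Prod>b\<in>A - {a}. [:- b, 1:] ^ m b)"
      by (simp only: power_Suc prod.distrib)
    moreover have "(\<Prod>b\<in>A. [:- b, 1:] ^ m b) =
        [:- a, 1:] ^ m a * (\<Prod>b\<in>A - {a}. [:- b, 1:] ^ m b)"
      using assms that by (rule prod.remove)
    ultimately show ?thesis
      by (simp only: mult_smult_left mult_smult_right mult_ac)
  qed
  then show ?thesis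
    by (simp only: pderiv_prod sum_distrib_left cong: sum.cong)
qed

text \<open>Induction on \<open>A\<close>: the denominator of each new weight is multiplied into
  \<open>N\<close>. Positivity of the weights gives positive integers, hence the form
  \<open>Suc (m a)\<close>.\<close>

lemma common_denominator:
  fixes w :: "'a \<Rightarrow> rat"
  assumes "finite A" "\<And>a. a \<in> A \<Longrightarrow> w a > 0"
  obtains N :: nat and m where "N > 0" "\<And>a. a \<in> A \<Longrightarrow> of_nat N * w a = of_nat (Suc (m a))"
proof -
  have "\<exists>N>0. \<forall>a\<in>A. \<exists>k>0. of_nat N * w a = of_nat k"
    using assms
  proof (induction A)
    case empty
    show ?case
      by (intro exI[of _ "1::nat"]) simp
  next
    case (insert x A)
    then obtain N where N: "N > 0" "\<forall>a\<in>A. \<exists>k>0. of_nat N * w a = of_nat k"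
      by auto
    obtain p q :: int where pq: "w x = of_int p / of_int q" "q > 0"
      by (metis quotient_of_denom_pos quotient_of_div surj_pair)
    then have "p > 0"
      using insert.prems[of x] by (simp add: zero_less_divide_iff)
    have wx: "of_nat (nat q) * w x = of_nat (nat p)"
      using pq \<open>p > 0\<close> by simp
    have "\<exists>k>0. of_nat (N * nat q) * w a = of_nat k" if a: "a \<in> insert x A" for a
    proof (cases "a = x")
      case True
      then have "of_nat (N * nat q) * w a = of_nat (N * nat p)"
        by (simp only: of_nat_mult mult.assoc wx)
      moreover have "N * nat p > 0"
        using \<open>N > 0\<close> \<open>p > 0\<close> by simp
      ultimately show ?thesis
        by blast
    next
      case False
      then obtain k where k: "k > 0" "of_nat N * w a = of_nat k"
        using a N by auto
      then have "of_nat (N * nat q) * w a = of_nat (k * nat q)"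
        by (metis (no_types) mult.assoc mult.commute of_nat_mult)
      moreover have "k * nat q > 0"
        using k \<open>q > 0\<close> by simp
      ultimately show ?thesis
        by blast
    qed
    moreover have "N * nat q > 0"
      using N \<open>q > 0\<close> by simp
    ultimately show ?case
      by blast
  qed
  then obtain N where "N > 0" "\<forall>a\<in>A. \<exists>m. of_nat N * w a = of_nat (Suc m)"
    by (metis gr0_conv_Suc)
  then show thesis
    using that by metis
qed

section \<open>Interlacing rationals and the signs of the residues\<close>

lemma interlacing_rationals:
  fixes x :: "nat \<Rightarrow> real"
  assumes "strict_mono_on {..<d} x"
  obtains a :: "nat \<Rightarrow> rat"
    where "\<And>i j. i < d \<Longrightarrow> j \<le> i \<Longrightarrow> of_rat (a j) < x i"
      and "\<And>i j. i < j \<Longrightarrow> j \<le> d \<Longrightarrow> x i < of_rat (a j)"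
proof -
  \<comment> \<open>\<open>lo j\<close> and \<open>hi j\<close> bound the gap between consecutive
    roots in which \<open>a j\<close> is chosen; the outermost gaps are cut to length 1. The
    interval is nonempty for every natural \<open>j\<close>, so the choice carries no side
    condition.\<close>
  define lo where "lo j = (if j = 0 then x 0 - 1 else x (j - 1))" for j
  define hi where "hi j = (if j < d then x j else lo j + 1)" for j
  have "lo j < hi j" for j
    using strict_mono_onD[OF assms, of "j - 1" j] by (auto simp: lo_def hi_def)
  then have "\<exists>q. lo j < of_rat q \<and> of_rat q < hi j" for j
    by (rule of_rat_dense)
  then obtain a where a: "\<And>j. lo j < of_rat (a j)" "\<And>j. of_rat (a j) < hi j"
    by metis
  have mono: "x i \<le> x j" if "i \<le> j" "j < d" for i j
    using strict_mono_onD[OF assms, of i j] that by (cases "i = j") auto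
  show thesis
  proof
    fix i j assume "i < d" "j \<le> i"
    then show "of_rat (a j) < x i"
      using a(2)[of j] mono[of j i] by (simp add: hi_def)
  next
    fix i j assume "i < j" "j \<le> d"
    then have "x i \<le> x (j - 1)"
      by (intro mono) auto
    then show "x i < of_rat (a j)"
      using a(1)[of j] \<open>i < j\<close> by (simp add: lo_def)
  qed
qed

text \<open>Pair \<open>x i\<close> with \<open>a i\<close> for \<open>i < j\<close> and with
  \<open>a (Suc i)\<close> for \<open>i \<ge> j\<close>. In the first case both differences from
  \<open>a j\<close> are positive, in the second both are negative, so every ratio is
  positive.\<close>

lemma interlacing_quotient_pos:
  fixes x a :: "nat \<Rightarrow> real"
  assumes "\<And>i j. i < d \<Longrightarrow> j \<le> i \<Longrightarrow> a j < x i"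
    and "\<And>i j. i < j \<Longrightarrow> j \<le> d \<Longrightarrow> x i < a j"
    and "j \<le> d"
  shows "(\<Prod>i<d. a j - x i) / (\<Prod>i\<in>{..d} - {j}. a j - a i) > 0"
proof -
  have mono: "a i < a k" if "i < k" "k \<le> d" for i k
    using assms(1)[of i i] assms(2)[of i k] that by simp
  have "{..<d} = {..<j} \<union> {j..<d}"
    using \<open>j \<le> d\<close> by auto
  then have num: "(\<Prod>i<d. a j - x i) = (\<Prod>i<j. a j - x i) * (\<Prod>i\<in>{j..<d}. a j - x i)"
    by (simp add: prod.union_disjoint ivl_disj_int)
  have "{..d} - {j} = {..<j} \<union> {Suc j..<Suc d}"
    using \<open>j \<le> d\<close> by auto
  moreover have "{..<j} \<inter> {Suc j..<Suc d} = {}"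
    by auto
  ultimately have "(\<Prod>i\<in>{..d} - {j}. a j - a i) =
      (\<Prod>i<j. a j - a i) * (\<Prod>i\<in>{Suc j..<Suc d}. a j - a i)"
    by (simp add: prod.union_disjoint)
  also have "(\<Prod>i\<in>{Suc j..<Suc d}. a j - a i) = (\<Prod>i\<in>{j..<d}. a j - a (Suc i))"
    by (rule prod.shift_bounds_Suc_ivl)
  finally have den: "(\<Prod>i\<in>{..d} - {j}. a j - a i) =
      (\<Prod>i<j. a j - a i) * (\<Prod>i\<in>{j..<d}. a j - a (Suc i))" .
  have "(\<Prod>i<d. a j - x i) / (\<Prod>i\<in>{..d} - {j}. a j - a i) =
      (\<Prod>i<j. (a j - x i) / (a j - a i)) * (\<Prod>i\<in>{j..<d}. (a j - x i) / (a j - a (Suc i)))"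
    by (simp add: num den prod_dividef)
  also have "\<dots> > 0"
    using assms mono by (intro mult_pos_pos prod_pos) (auto intro: divide_neg_neg)
  finally show ?thesis .
qed

section \<open>Construction of the product of rational linear powers, and enumeration of the real
  roots\<close>

lemma smult_sum_right: "smult c (\<Sum>i\<in>A. p i) = (\<Sum>i\<in>A. smult c (p i))"
  by (induction A rule: infinite_finite_induct) (simp_all add: smult_add_right)

text \<open>The factorisation of \<open>f\<close> over the reals is assumed only through values at
  rationals, because signs of \<open>f\<close> are needed only at the rational nodes.\<close>

lemma exists_antiderivative_multiple:
  fixes f :: "rat poly" and x :: "nat \<Rightarrow> real"
  assumes "f \<noteq> 0"
    and x: "strict_mono_on {..<degree f} x"
    and f: "\<And>q. of_rat (poly f q) = of_rat (lead_coeff f) * (\<Prod>i<degree f. of_rat q - x i)"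
  obtains A :: "rat set" and m where "finite A" "A \<noteq> {}"
    "f dvd pderiv (\<Prod>a\<in>A. [:- a, 1:] ^ Suc (m a))"
proof -
  define d where "d = degree f"
  define c where "c = lead_coeff f"
  have "c \<noteq> 0"
    using assms(1) by (simp add: c_def)
  obtain a :: "nat \<Rightarrow> rat"
    where less: "\<And>i j. i < d \<Longrightarrow> j \<le> i \<Longrightarrow> of_rat (a j) < x i"
      and greater: "\<And>i j. i < j \<Longrightarrow> j \<le> d \<Longrightarrow> x i < of_rat (a j)"
    using interlacing_rationals[OF x] unfolding d_def by blast
  have mono: "a i < a k" if "i < k" "k \<le> d" for i k
  proof -
    have "(of_rat (a i) :: real) < of_rat (a k)"
      using less[of i i] greater[of i k] that by simp
    then show ?thesis
      by (simp add: of_rat_less)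
  qed
  have inj: "inj_on a {..d}"
    by (rule linorder_inj_onI) (use mono in force)+
  define A where "A = a ` {..d}"
  have "finite A" "A \<noteq> {}"
    by (auto simp: A_def)
  have card: "card A = Suc d"
    using inj by (simp add: A_def card_image)
  \<comment> \<open>For \<open>q\<close> in \<open>A\<close> this is the derivative at
    \<open>q\<close> of the product of all \<open>[:- b, 1:]\<close> with \<open>b\<close> in
    \<open>A\<close>.\<close>
  define D where "D q = (\<Prod>b\<in>A - {q}. q - b)" for q
  \<comment> \<open>Dividing by \<open>c\<close> normalises the sign, as \<open>poly f q / c\<close>
    is the product of the \<open>q - x i\<close>. Positivity is shown in the reals, where the
    \<open>x i\<close> live, and pulled back along \<open>of_rat\<close>.\<close>
  have pos: "poly f q / (c * D q) > 0" if q: "q \<in> A" for q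
  proof -
    obtain j where j: "q = a j" "j \<le> d"
      using q by (auto simp: A_def)
    have "A - {q} = a ` ({..d} - {j})"
      using inj j by (auto simp: A_def inj_on_def)
    then have "D q = (\<Prod>i\<in>{..d} - {j}. a j - a i)"
      unfolding D_def using inj_on_subset[OF inj, of "{..d} - {j}"] j
      by (simp add: prod.reindex)
    then have "of_rat (D q) = (\<Prod>i\<in>{..d} - {j}. of_rat (a j) - of_rat (a i) :: real)"
      by (simp add: of_rat_prod of_rat_diff)
    then have "of_rat (poly f q / (c * D q)) =
        (\<Prod>i<d. of_rat (a j) - x i) / (\<Prod>i\<in>{..d} - {j}. of_rat (a j) - of_rat (a i))"
      using f[of q] \<open>c \<noteq> 0\<close> by (simp add: of_rat_divide of_rat_mult j c_def d_def)
    also have "\<dots> > 0"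
      by (rule interlacing_quotient_pos) (use less greater j in auto)
    finally show ?thesis
      by (simp only: zero_less_of_rat_iff)
  qed
  obtain N m where "N > 0"
    and Nm: "\<And>q. q \<in> A \<Longrightarrow> of_nat N * (poly f q / (c * D q)) = of_nat (Suc (m q))"
    using common_denominator[of A "\<lambda>q. poly f q / (c * D q)", OF \<open>finite A\<close> pos] by blast
  \<comment> \<open>Lagrange interpolation applies because there are \<open>d + 1\<close> nodes.
    Scaling by \<open>of_nat N / c\<close> turns its coefficients into the exponents
    \<open>Suc (m q)\<close>.\<close>
  have "smult (of_nat N / c) f =
      smult (of_nat N / c) (\<Sum>q\<in>A. smult (poly f q / D q) (\<Prod>b\<in>A - {q}. [:- b, 1:]))"
    unfolding D_def using lagrange_interpolation[OF \<open>finite A\<close>, of f] card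
    by (intro arg_cong[where f = "smult _"]) (simp only: d_def lessI)
  also have "\<dots> = (\<Sum>q\<in>A. smult (of_nat (Suc (m q))) (\<Prod>b\<in>A - {q}. [:- b, 1:]))"
    unfolding smult_sum_right
  proof (rule sum.cong)
    fix q assume "q \<in> A"
    have "of_nat N / c * (poly f q / D q) = of_nat (Suc (m q))"
      using Nm[OF \<open>q \<in> A\<close>] by (simp add: field_simps)
    then show "smult (of_nat N / c) (smult (poly f q / D q) (\<Prod>b\<in>A - {q}. [:- b, 1:])) =
        smult (of_nat (Suc (m q))) (\<Prod>b\<in>A - {q}. [:- b, 1:])"
      by (simp only: smult_smult)
  qed simp
  finally have "pderiv (\<Prod>a\<in>A. [:- a, 1:] ^ Suc (m a)) =
      (\<Prod>a\<in>A. [:- a, 1:] ^ m a) * smult (of_nat N / c) f"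
    by (simp only: pderiv_prod_linear_powers[OF \<open>finite A\<close>])
  then have "f dvd pderiv (\<Prod>a\<in>A. [:- a, 1:] ^ Suc (m a))"
    by (simp only: dvd_mult dvd_smult dvd_refl)
  with \<open>finite A\<close> \<open>A \<noteq> {}\<close> show thesis
    by (rule that)
qed

text \<open>Having simple roots, the complex polynomial is its leading coefficient times the product
  over the set of its roots, so this set has \<open>degree f\<close> elements. All of them are real,
  and sorting them gives \<open>x\<close>.\<close>

lemma real_roots_enumeration:
  fixes f :: "rat poly"
  assumes sf: "rsquarefree (map_poly of_rat f :: complex poly)"
    and real: "\<And>z::complex. poly (map_poly of_rat f) z = 0 \<Longrightarrow> z \<in> \<real>"
  obtains x :: "nat \<Rightarrow> real" where "strict_mono_on {..<degree f} x"
    "\<And>q. of_rat (poly f q) = of_rat (lead_coeff f) * (\<Prod>i<degree f. of_rat q - x i)"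
proof -
  define h :: "complex poly" where "h = map_poly of_rat f"
  have "h \<noteq> 0"
    using sf by (simp add: h_def rsquarefree_def)
  define R where "R = Re ` {z. poly h z = 0}"
  have "finite R"
    unfolding R_def using \<open>h \<noteq> 0\<close> by (simp add: poly_roots_finite)
  have roots: "{z. poly h z = 0} = of_real ` R"
    using real by (force simp: R_def h_def image_iff elim!: Reals_cases)
  have h: "h = smult (lead_coeff h) (\<Prod>r\<in>R. [:- of_real r, 1:])"
    using complex_poly_decompose_rsquarefree[of h] sf
    by (simp add: h_def[symmetric] roots prod.reindex inj_on_def)
  have "degree h = degree (\<Prod>r\<in>R. [:- complex_of_real r, 1:])"
    using \<open>h \<noteq> 0\<close> by (subst h) simp
  then have deg: "degree f = card R"
    by (simp add: h_def degree_prod_sum_eq)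
  define xs where "xs = sorted_list_of_set R"
  have len: "length xs = card R"
    by (simp add: xs_def)
  have "strict_mono_on {..<degree f} (nth xs)"
    using strict_sorted_list_of_set[of R] len
    by (intro strict_mono_onI) (auto simp: deg xs_def[symmetric] intro: sorted_wrt_nth_less)
  moreover have "of_rat (poly f q) = of_rat (lead_coeff f) * (\<Prod>i<degree f. of_rat q - xs ! i)" for q
  proof -
    \<comment> \<open>The factorisation is evaluated in the complex numbers and brought back to the
      reals by injectivity of \<open>of_real\<close>.\<close>
    have "complex_of_real (of_rat (poly f q)) = poly h (of_rat q)"
      by (simp add: h_def poly_map_poly_of_rat)
    also have "\<dots> = of_rat (lead_coeff f) * (\<Prod>r\<in>R. of_rat q - of_real r)"
      by (subst h) (simp add: poly_prod h_def)
    also have "\<dots> = of_real (of_rat (lead_coeff f) * (\<Prod>r\<in>R. of_rat q - r))"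
      by simp
    finally have "of_rat (poly f q) = of_rat (lead_coeff f) * (\<Prod>r\<in>R. of_rat q - r)"
      by (simp only: of_real_eq_iff)
    moreover have "bij_betw (nth xs) {..<degree f} R"
      using \<open>finite R\<close> by (intro bij_betw_nth) (simp_all add: deg xs_def)
    ultimately show ?thesis
      by (simp add: prod.reindex_bij_betw)
  qed
  ultimately show thesis
    by (rule that)
qed

text \<open>The condition \<open>degree F > 0\<close> excludes nonzero constants: they have no roots
  and derivative 0, so they would satisfy the rest for every \<open>f\<close>.\<close>

theorem theorem1:
  fixes f :: "rat poly"
  assumes "irreducible f"
  shows "(\<forall>z::complex. poly (map_poly of_rat f) z = 0 \<longrightarrow> z \<in> \<real>) \<longleftrightarrow>
    (\<exists>F :: rat poly. degree F > 0 \<and>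
       (\<forall>z::complex. poly (map_poly of_rat F) z = 0 \<longrightarrow> z \<in> \<rat>) \<and>
       f dvd pderiv F)"
proof
  assume real: "\<forall>z::complex. poly (map_poly of_rat f) z = 0 \<longrightarrow> z \<in> \<real>"
  have "f \<noteq> 0"
    using assms by auto
  obtain x :: "nat \<Rightarrow> real" where x: "strict_mono_on {..<degree f} x"
    "\<And>q. of_rat (poly f q) = of_rat (lead_coeff f) * (\<Prod>i<degree f. of_rat q - x i)"
    using real_roots_enumeration[OF irreducible_imp_rsquarefree_map_poly_of_rat[OF assms]] real
    by blast
  then obtain A m where A: "finite A" "A \<noteq> {}"
    and dvd: "f dvd pderiv (\<Prod>a\<in>A. [:- a, 1:] ^ Suc (m a))"
    using exists_antiderivative_multiple[OF \<open>f \<noteq> 0\<close> x] by blast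
  define F where "F = (\<Prod>a\<in>A. [:- a, 1:] ^ Suc (m a))"
  have "degree F = (\<Sum>a\<in>A. Suc (m a))"
    unfolding F_def by (subst degree_prod_sum_eq) (simp_all add: degree_power_eq del: power_Suc)
  also have "\<dots> > 0"
    using A by (intro sum_pos) auto
  finally have "degree F > 0" .
  moreover have "z \<in> \<rat>" if "poly (map_poly of_rat F) z = 0" for z :: complex
    using that A
    by (auto simp: F_def poly_map_poly_of_rat_prod_linear prod_zero_iff simp del: power_Suc)
  ultimately show "\<exists>F :: rat poly. degree F > 0 \<and>
       (\<forall>z::complex. poly (map_poly of_rat F) z = 0 \<longrightarrow> z \<in> \<rat>) \<and> f dvd pderiv F"
    using dvd F_def by blast
next
  assume "\<exists>F :: rat poly. degree F > 0 \<and>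
       (\<forall>z::complex. poly (map_poly of_rat F) z = 0 \<longrightarrow> z \<in> \<rat>) \<and> f dvd pderiv F"
  then obtain F g where F: "degree F > 0"
    and rational: "\<And>z::complex. poly (map_poly of_rat F) z = 0 \<Longrightarrow> z \<in> \<rat>"
    and "pderiv F = f * g"
    unfolding dvd_def by blast
  show "\<forall>z::complex. poly (map_poly of_rat f) z = 0 \<longrightarrow> z \<in> \<real>"
  proof (intro allI impI)
    fix z :: complex
    assume "poly (map_poly of_rat f) z = 0"
    \<comment> \<open>A root of \<open>f\<close> is a critical point of \<open>F\<close>, whose
      roots are rational and hence real, so the Gauss-Lucas argument applies.\<close>
    then have "poly (pderiv (map_poly of_rat F)) z = 0"
      using \<open>pderiv F = f * g\<close>
      by (metis map_poly_of_rat_mult map_poly_of_rat_pderiv mult_zero_left poly_mult)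
    moreover have "w \<in> \<real>" if "poly (map_poly of_rat F) w = 0" for w :: complex
      using rational[OF that] by (metis Rats_cases Reals_of_real of_real_of_rat)
    ultimately show "z \<in> \<real>"
      using real_roots_pderiv[of "map_poly of_rat F" z] F by simp
  qed
qed

end
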